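(* Assume the setting and assumptions A1–A4 described in the context. Consider the Composite Mirror Prox recurrence $$x_1=[u_1;v_1]\in X,\qquad y_\tau=[u'_\tau;v'_\tau]=P_{x_\tau}(\gamma_\tau F(x_\tau)),\qquad x_{\tau+1}=[u_{\tau+1};v_{\tau+1}]=P_{x_\tau}(\gamma_\tau F(y_\tau)),\qquad \tau=1,2,\dots$$ with stepsizes $\gamma_\tau>0$ such that for all $\tau$ $$\gamma_\tau\langle F_u(u'_\tau)-F_u(u_\tau),u'_\tau-u_{\tau+1}\rangle-V_{u'_\tau}(u_{\tau+1})-V_{u_\tau}(u'_\tau)\le\gamma_\tau^2M^2.$$ For $t=1,2,\dots$ set $x^t=[u^t;v^t]=\big(\sum_{\tau=1}^t\gamma_\tau\big)^{-1}\sum_{\tau=1}^t\gamma_\tau y_\tau$, and for $X'\subset X$ set $\Theta[X']=\sup_{[u;v]\in X'}V_{u_1}(u)$. Then $x^t\in X$ and: (i) If $F$ is monotone on $X$, then $$\epsilon_{\rm VI}(x^t|X,F)\le\Big[\sum_{\tau=1}^t\gamma_\tau\Big]^{-1}\Big[\Theta[X]+M^2\sum_{\tau=1}^t\gamma_\tau^2\Big].$$ (ii) Let $X=X_1\times X_2$, and let $F$ be the monotone vector field associated with the saddle point problem $\min_{x^1\in X_1}\max_{x^2\in X_2}\Phi(x^1,x^2)$ with convex-concave locally Lipschitz continuous cost function $\Phi$. Then $$\epsilon_{\rm Sad}(x^t|X_1,X_2,\Phi)\le\Big[\sum_{\tau=1}^t\gamma_\tau\Big]^{-1}\Big[\Theta[X]+M^2\sum_{\tau=1}^t\gamma_\tau^2\Big].$$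 In addition, if the problem $\mathrm{Opt}(P)=\min_{x^1\in X_1}\overline\Phi(x^1)$, $\overline\Phi(x^1)=\sup_{x^2\in X_2}\Phi(x^1,x^2)$, is solvable with optimal solution $x^1_*$, and $x^{1,t}$ denotes the projection of $x^t\in X_1\times X_2$ onto $X_1$, then $$\overline\Phi(x^{1,t})-\mathrm{Opt}(P)\le\Big[\sum_{\tau=1}^t\gamma_\tau\Big]^{-1}\Big[\Theta[\{x^1_*\}\times X_2]+M^2\sum_{\tau=1}^t\gamma_\tau^2\Big].$$
   Context: Setting. $E_u,E_v$ are Euclidean spaces, $E=E_u\times E_v$, $U\subset E_u$ is a nonempty closed convex set and $X\subset E$ is a nonempty closed convex set; vectors of $E$ are written $x=[u;v]$ with $u\in E_u$, $v\in E_v$. A1: $E_u$ is equipped with a norm $\|\cdot\|$ with conjugate norm $\|\cdot\|_*$, and $U$ with a distance-generating function $\omega:U\to\mathbf R$, i.e. a continuously differentiable convex function, which is strongly convex with modulus 1 w.r.t. $\|\cdot\|$. The Bregman distance is $V_u(w)=\omega(w)-\omega(u)-\langle\omega'(u),w-u\rangle$ for $u,w\in U$. A2: $u\in U$ for every $[u;v]\in X$. A3: $F:X\to E$ is a vector field of the form $F(u,v)=[F_u(u);F_v]$ with $F_u(u)\in E_u$ (defined for $u\in U$) and a constant vector $F_v\in E_v$, and $\|F_u(u)-F_u(u')\|_*\le L\|u-u'\|+M$ for all $u,u'\in U$, with some finite $L,M\ge 0$. A4: the linear form $\langle F_v,v\rangle$ of $[u;v]$ is bounded from below on $X$ and coercive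 on $X$ w.r.t. $v$: whenever $[u_t;v_t]\in X$, $t=1,2,\dots$, is such that $\{u_t\}$ is bounded and $\|v_t\|_2\to\infty$, one has $\langle F_v,v_t\rangle\to\infty$. Prox-mapping: for $\xi=[\eta;\zeta]\in E$ and $x=[u;v]\in X$, $P_x(\xi)$ is a point of $\operatorname{Argmin}_{[s;w]\in X}\{\langle\eta,s\rangle+\langle\zeta,w\rangle+V_u(s)\}$ (any selected minimizer; under A1–A4 this set is nonempty when $\zeta=\gamma F_v$ with $\gamma>0$). $F$ is monotone on $X$ if $\langle F(x)-F(y),x-y\rangle\ge0$ for all $x,y\in X$. Dual gap function: $\epsilon_{\rm VI}(x|X,F)=\sup_{y\in X}\langle F(y),x-y\rangle$. Saddle point notions (part (ii)): $E$ is also represented as a product $E=E_1\times E_2$ of Euclidean spaces, $X_i\subset E_i$ are closed convex, $\Phi:X_1\times X_2\to\mathbf R$ is locally Lipschitz continuous, convex in $x^1$ and concave in $x^2$. The associated vector field is any $F=[F_1;F_2]$ with $F_1(x^1,x^2)\in\partial_{x^1}\Phi(x^1,x^2)$ and $F_2(x^1,x^2)\in\partial_{x^2}[-\Phi(x^1,x^2)]$ for all $(x^1,x^2)\in X_1\times X_2$; it is monotone. With $\overline\Phi(x^1)=\sup_{x^2\in X_2}\Phi(x^1,x^2)$ and $\underline\Phi(x^2)=\inf_{x^1\in X_1}\Phi(x^1,x^2)$, $\epsilon_{\rm Sad}([x^1;x^2]|X_1,X_2,\Phi)=\overline\Phi(x^1)-\underline\Phi(x^2)$. Standing assumption: saddle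 point problems are proper, i.e. $\inf_{X_1}\overline\Phi$ and $\sup_{X_2}\underline\Phi$ are real numbers. *)

theory Defs
  imports "HOL-Analysis.Analysis"
begin

text \<open>The space of the \<open>u\<close>-components carries, besides its Euclidean structure, an arbitrary norm.
  It is therefore a function \<open>N\<close> rather than the type class operation \<^const>\<open>norm\<close>, which always
  is the Euclidean norm here.\<close>

definition is_norm :: "('a::real_vector \<Rightarrow> real) \<Rightarrow> bool" where
  "is_norm N \<longleftrightarrow>
     (\<forall>x. 0 \<le> N x) \<and> (\<forall>x. N x = 0 \<longleftrightarrow> x = 0) \<and>
     (\<forall>c x. N (c *\<^sub>R x) = \<bar>c\<bar> * N x) \<and> (\<forall>x y. N (x + y) \<le> N x + N y)"

definition conj_norm :: "('a::real_inner \<Rightarrow> real) \<Rightarrow> 'a \<Rightarrow> real" where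
  "conj_norm N \<xi> = (SUP x\<in>{x. N x \<le> 1}. \<xi> \<bullet> x)"

definition strongly_convex_on :: "real \<Rightarrow> ('a::real_vector \<Rightarrow> real) \<Rightarrow> 'a set \<Rightarrow> ('a \<Rightarrow> real) \<Rightarrow> bool" where
  "strongly_convex_on \<mu> N U f \<longleftrightarrow> convex U \<and>
     (\<forall>x\<in>U. \<forall>y\<in>U. \<forall>a\<ge>0. \<forall>b\<ge>0. a + b = 1 \<longrightarrow>
        f (a *\<^sub>R x + b *\<^sub>R y) \<le> a * f x + b * f y - \<mu> / 2 * a * b * (N (x - y))\<^sup>2)"

text \<open>\<open>\<omega>'\<close> is the gradient field of \<open>\<omega>\<close> relative to \<open>U\<close>. No interior of \<open>U\<close> is assumed. If \<open>U\<close> is not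
  full-dimensional, \<open>\<omega>'\<close> is determined only up to vectors orthogonal to \<open>U - U\<close>, which
  does not affect the Bregman distance between points of \<open>U\<close>.\<close>

definition dist_gen_fun ::
  "('a::euclidean_space \<Rightarrow> real) \<Rightarrow> 'a set \<Rightarrow> ('a \<Rightarrow> real) \<Rightarrow> ('a \<Rightarrow> 'a) \<Rightarrow> bool" where
  "dist_gen_fun N U \<omega> \<omega>' \<longleftrightarrow>
     convex_on U \<omega> \<and>
     (\<forall>u\<in>U. (\<omega> has_derivative (\<lambda>h. \<omega>' u \<bullet> h)) (at u within U)) \<and> continuous_on U \<omega>' \<and>
     strongly_convex_on 1 N U \<omega>"

definition bregman :: "('a::real_inner \<Rightarrow> real) \<Rightarrow> ('a \<Rightarrow> 'a) \<Rightarrow> 'a \<Rightarrow> 'a \<Rightarrow> real" where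
  "bregman \<omega> \<omega>' u w = \<omega> w - \<omega> u - \<omega>' u \<bullet> (w - u)"

definition coercive_wrt_snd :: "('a::euclidean_space \<times> 'b::euclidean_space) set \<Rightarrow> 'b \<Rightarrow> bool" where
  "coercive_wrt_snd X c \<longleftrightarrow>
     (\<forall>s :: nat \<Rightarrow> 'a \<times> 'b.
        (\<forall>t. s t \<in> X) \<and> bounded (range (\<lambda>t. fst (s t))) \<and>
        filterlim (\<lambda>t. norm (snd (s t))) at_top sequentially \<longrightarrow>
        filterlim (\<lambda>t. c \<bullet> snd (s t)) at_top sequentially)"

text \<open>The set of all values the prox-mapping \<open>P\<^sub>x(\<xi>)\<close> may take.\<close>

definition prox_set ::
  "('u::euclidean_space \<Rightarrow> real) \<Rightarrow> ('u \<Rightarrow> 'u) \<Rightarrow> ('u \<times> 'v::euclidean_space) set \<Rightarrow>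
     'u \<times> 'v \<Rightarrow> 'u \<times> 'v \<Rightarrow> ('u \<times> 'v) set" where
  "prox_set \<omega> \<omega>' X x \<xi> =
     {z. is_arg_min (\<lambda>z. fst \<xi> \<bullet> fst z + snd \<xi> \<bullet> snd z + bregman \<omega> \<omega>' (fst x) (fst z))
           (\<lambda>z. z \<in> X) z}"

definition composite_field :: "('u \<Rightarrow> 'u) \<Rightarrow> 'v \<Rightarrow> 'u \<times> 'v \<Rightarrow> 'u \<times> 'v" where
  "composite_field Fu Fv x = (Fu (fst x), Fv)"

definition monotone_field_on :: "'a::real_inner set \<Rightarrow> ('a \<Rightarrow> 'a) \<Rightarrow> bool" where
  "monotone_field_on X F \<longleftrightarrow> (\<forall>x\<in>X. \<forall>y\<in>X. 0 \<le> (F x - F y) \<bullet> (x - y))"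

definition eps_VI :: "'a::real_inner set \<Rightarrow> ('a \<Rightarrow> 'a) \<Rightarrow> 'a \<Rightarrow> ereal" where
  "eps_VI X F x = (SUP y\<in>X. ereal (F y \<bullet> (x - y)))"

definition weighted_avg :: "(nat \<Rightarrow> real) \<Rightarrow> (nat \<Rightarrow> 'a::real_vector) \<Rightarrow> nat \<Rightarrow> 'a" where
  "weighted_avg \<gamma> y t = inverse (\<Sum>\<tau>=1..t. \<gamma> \<tau>) *\<^sub>R (\<Sum>\<tau>=1..t. \<gamma> \<tau> *\<^sub>R y \<tau>)"

definition Theta ::
  "('u::real_inner \<Rightarrow> real) \<Rightarrow> ('u \<Rightarrow> 'u) \<Rightarrow> 'u \<Rightarrow> ('u \<times> 'v) set \<Rightarrow> ereal" where
  "Theta \<omega> \<omega>' u\<^sub>1 X' = (SUP z\<in>X'. ereal (bregman \<omega> \<omega>' u\<^sub>1 (fst z)))"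

definition locally_lipschitz_on :: "'a::metric_space set \<Rightarrow> ('a \<Rightarrow> 'b::metric_space) \<Rightarrow> bool" where
  "locally_lipschitz_on S f \<longleftrightarrow> (\<forall>z\<in>S. \<exists>r>0. \<exists>K. K-lipschitz_on (cball z r \<inter> S) f)"

definition subdifferential :: "'a::real_inner set \<Rightarrow> ('a \<Rightarrow> real) \<Rightarrow> 'a \<Rightarrow> 'a set" where
  "subdifferential S f x = {g. \<forall>y\<in>S. f x + g \<bullet> (y - x) \<le> f y}"

definition Phi_upper :: "'b set \<Rightarrow> ('a \<Rightarrow> 'b \<Rightarrow> real) \<Rightarrow> 'a \<Rightarrow> ereal" where
  "Phi_upper X2 \<Phi> x1 = (SUP x2\<in>X2. ereal (\<Phi> x1 x2))"

definition Phi_lower :: "'a set \<Rightarrow> ('a \<Rightarrow> 'b \<Rightarrow> real) \<Rightarrow> 'b \<Rightarrow> ereal" where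
  "Phi_lower X1 \<Phi> x2 = (INF x1\<in>X1. ereal (\<Phi> x1 x2))"

definition Opt_P :: "'a set \<Rightarrow> 'b set \<Rightarrow> ('a \<Rightarrow> 'b \<Rightarrow> real) \<Rightarrow> ereal" where
  "Opt_P X1 X2 \<Phi> = (INF x1\<in>X1. Phi_upper X2 \<Phi> x1)"

definition eps_Sad :: "'a set \<Rightarrow> 'b set \<Rightarrow> ('a \<Rightarrow> 'b \<Rightarrow> real) \<Rightarrow> 'a \<times> 'b \<Rightarrow> ereal" where
  "eps_Sad X1 X2 \<Phi> x = Phi_upper X2 \<Phi> (fst x) - Phi_lower X1 \<Phi> (snd x)"

definition saddle_proper :: "'a set \<Rightarrow> 'b set \<Rightarrow> ('a \<Rightarrow> 'b \<Rightarrow> real) \<Rightarrow> bool" where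
  "saddle_proper X1 X2 \<Phi> \<longleftrightarrow>
     \<bar>INF x1\<in>X1. Phi_upper X2 \<Phi> x1\<bar> \<noteq> \<infinity> \<and> \<bar>SUP x2\<in>X2. Phi_lower X1 \<Phi> x2\<bar> \<noteq> \<infinity>"

definition convex_concave_cost ::
  "'a::euclidean_space set \<Rightarrow> 'b::euclidean_space set \<Rightarrow> ('a \<Rightarrow> 'b \<Rightarrow> real) \<Rightarrow> bool" where
  "convex_concave_cost X1 X2 \<Phi> \<longleftrightarrow>
     locally_lipschitz_on (X1 \<times> X2) (\<lambda>(x1, x2). \<Phi> x1 x2) \<and>
     (\<forall>x2\<in>X2. convex_on X1 (\<lambda>x1. \<Phi> x1 x2)) \<and> (\<forall>x1\<in>X1. concave_on X2 (\<Phi> x1))"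

text \<open>The second representation \<open>E = E\<^sub>1 \<times> E\<^sub>2\<close> of the Euclidean space \<open>E\<close> is an isometric
  isomorphism \<open>J\<close>, which need not be compatible with the splitting of \<open>E\<close> into \<open>u\<close>- and
  \<open>v\<close>-components.\<close>

definition euclidean_iso :: "('a::real_inner \<Rightarrow> 'b::real_inner) \<Rightarrow> bool" where
  "euclidean_iso J \<longleftrightarrow> linear J \<and> bij J \<and> (\<forall>x y. J x \<bullet> J y = x \<bullet> y)"

definition associated_field ::
  "('e::euclidean_space \<Rightarrow> 'a::euclidean_space \<times> 'b::euclidean_space) \<Rightarrow> 'a set \<Rightarrow> 'b set \<Rightarrow>
     ('a \<Rightarrow> 'b \<Rightarrow> real) \<Rightarrow> ('e \<Rightarrow> 'e) \<Rightarrow> bool" where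
  "associated_field J X1 X2 \<Phi> F \<longleftrightarrow>
     (\<forall>z x1 x2. J z = (x1, x2) \<and> x1 \<in> X1 \<and> x2 \<in> X2 \<longrightarrow>
        fst (J (F z)) \<in> subdifferential X1 (\<lambda>x1. \<Phi> x1 x2) x1 \<and>
        snd (J (F z)) \<in> subdifferential X2 (\<lambda>x2. - \<Phi> x1 x2) x2)"

end

theory Submission
  imports Defs
begin

text \<open>
  Each prox-step minimises a linear form plus a Bregman distance over \<open>X\<close>. Its
  first-order optimality condition, read through the three-point identity of the Bregman
  distance, bounds the linear form of the displacement by a difference of Bregman distances
  (\<open>prox_three_point\<close>). The extrapolation step from \<open>x \<tau>\<close> to
  \<open>y \<tau>\<close> and the main step from \<open>x \<tau>\<close> to \<open>x (\<tau> +
  1)\<close> start at the same point, so adding their two inequalities cancels \<open>V\<^bsub>u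
  \<tau>\<^esub>(u (\<tau> + 1))\<close> (\<open>mirror_prox_step\<close>). What is left beyond
  the telescoping terms is exactly the quantity that the stepsize rule bounds by
  \<open>(\<gamma> \<tau>)\<^sup>2 M\<^sup>2\<close>; the constant component of the field drops
  out of it, which is why the Bregman distance only has to control \<open>u\<close>. Summing
  over the iterations and using that the final Bregman distance is nonnegative gives the regret
  bound (\<open>mirror_prox_regret\<close>)

  \<open>(\<Sum>\<tau>\<le>t. \<gamma> \<tau> * (F (y \<tau>) \<bullet> (y \<tau> - z))) \<le> V\<^bsub>u 1\<^esub>(z) + M\<^sup>2 * (\<Sum>\<tau>\<le>t. (\<gamma> \<tau>)\<^sup>2)\<close>

  for every \<open>z \<in> X\<close>. Each accuracy measure is at most a supremum of gaps at
  the averaged point, and every such gap is at most the left-hand side divided by the sum of the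
  stepsizes. In the variational inequality case monotonicity replaces \<open>F (y
  \<tau>)\<close> by \<open>F z\<close>, and the sum becomes linear in the averaged point
  (\<open>monotone_gap_avg_le_regret\<close>). In the saddle point case the subgradient
  inequalities bound \<open>F y \<bullet> (y - z)\<close> below by \<open>\<Phi>(y\<^sup>1,
  z\<^sup>2) - \<Phi>(z\<^sup>1, y\<^sup>2)\<close>, and Jensen's inequality passes to the
  averaged point (\<open>saddle_gap_avg_le_regret\<close>). Taking suprema over all
  \<open>z\<close>, or over those with \<open>z\<^sup>1\<close> optimal, gives the stated
  accuracy estimates.
\<close>

section \<open>Bregman distances and the prox-mapping\<close>

text \<open>Differentiability relative to a convex set suffices for difference quotients along segments:
  the segment joining two points of the set stays in it.\<close>

lemma directional_derivative_within_convex: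
  fixes f :: "'a::real_normed_vector \<Rightarrow> real"
  assumes d: "(f has_derivative f') (at u within U)"
    and "convex U" "u \<in> U" "w \<in> U"
  shows "((\<lambda>a. (f (u + a *\<^sub>R (w - u)) - f u) / a) \<longlongrightarrow> f' (w - u)) (at_right 0)"
proof -
  let ?g = "\<lambda>a::real. u + a *\<^sub>R (w - u)"
  have img: "?g ` {0..1} \<subseteq> U"
  proof (safe)
    fix a :: real assume "a \<in> {0..1}"
    then have "(1 - a) *\<^sub>R u + a *\<^sub>R w \<in> U"
      using assms by (intro convexD) auto
    then show "?g a \<in> U" by (simp add: algebra_simps)
  qed
  have g: "(?g has_derivative (\<lambda>a. a *\<^sub>R (w - u))) (at 0 within {0..1})"
    by (auto intro!: derivative_eq_intros)
  have "(f has_derivative f') (at (?g 0) within ?g ` {0..1})"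
    using has_derivative_subset[OF d img] by simp
  from has_derivative_in_compose[OF g this]
  have "((\<lambda>a. f (?g a)) has_derivative (\<lambda>a. f' (a *\<^sub>R (w - u)))) (at 0 within {0..1})" .
  moreover have "(\<lambda>a. f' (a *\<^sub>R (w - u))) = (*) (f' (w - u))"
    using linear_scale[OF has_derivative_linear[OF d]] by (auto simp: mult.commute)
  ultimately have "((\<lambda>a. f (?g a)) has_field_derivative f' (w - u)) (at 0 within {0..1})"
    by (simp add: has_field_derivative_def)
  then show ?thesis
    by (simp add: has_field_derivative_iff at_within_Icc_at_right)
qed

lemma bregman_nonneg:
  assumes "dist_gen_fun N U \<omega> \<omega>'" "u \<in> U" "w \<in> U"
  shows "0 \<le> bregman \<omega> \<omega>' u w"
proof -
  have cvx: "convex_on U \<omega>" and U: "convex U"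
    and d: "(\<omega> has_derivative (\<lambda>h. \<omega>' u \<bullet> h)) (at u within U)"
    using assms unfolding dist_gen_fun_def strongly_convex_on_def by auto
  note lim = directional_derivative_within_convex[OF d U assms(2,3)]
  have "(\<omega> (u + a *\<^sub>R (w - u)) - \<omega> u) / a \<le> \<omega> w - \<omega> u" if "0 < a" "a < 1" for a :: real
  proof -
    have "\<omega> ((1 - a) *\<^sub>R u + a *\<^sub>R w) \<le> (1 - a) * \<omega> u + a * \<omega> w"
      using that assms by (intro convex_onD[OF cvx]) auto
    then show ?thesis
      using that by (simp add: field_simps algebra_simps)
  qed
  then have "\<forall>\<^sub>F a in at_right (0::real). (\<omega> (u + a *\<^sub>R (w - u)) - \<omega> u) / a \<le> \<omega> w - \<omega> u"
    by (auto simp: eventually_at_right_field intro!: exI[of _ 1])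
  from tendsto_upperbound[OF lim this] show ?thesis
    by (simp add: bregman_def)
qed

lemma bregman_three_point:
  "bregman \<omega> \<omega>' u w - bregman \<omega> \<omega>' s w - bregman \<omega> \<omega>' u s = (\<omega>' s - \<omega>' u) \<bullet> (w - s)"
  by (simp add: bregman_def algebra_simps)

text \<open>The objective is nondecreasing to first order along the segment from the minimiser \<open>p\<close> to
  \<open>z\<close>, that is \<open>\<xi> \<bullet> (z - p) + (\<omega>' (fst p) - \<omega>' (fst x)) \<bullet> (fst z - fst p) \<ge> 0\<close>. By the three-point
  identity this is the claim.\<close>

lemma prox_three_point:
  fixes X :: "('u::euclidean_space \<times> 'v::euclidean_space) set"
  assumes \<omega>: "dist_gen_fun N U \<omega> \<omega>'" and X: "convex X" "\<And>z. z \<in> X \<Longrightarrow> fst z \<in> U"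
    and p: "p \<in> prox_set \<omega> \<omega>' X x \<xi>" and z: "z \<in> X"
  shows "\<xi> \<bullet> (p - z) \<le>
    bregman \<omega> \<omega>' (fst x) (fst z) - bregman \<omega> \<omega>' (fst p) (fst z) - bregman \<omega> \<omega>' (fst x) (fst p)"
proof -
  have pX: "p \<in> X"
    and min: "\<And>q. q \<in> X \<Longrightarrow> \<xi> \<bullet> p + bregman \<omega> \<omega>' (fst x) (fst p) \<le> \<xi> \<bullet> q + bregman \<omega> \<omega>' (fst x) (fst q)"
    using p unfolding prox_set_def is_arg_min_def by (auto simp: not_less inner_prod_def)
  have U: "convex U" and d: "(\<omega> has_derivative (\<lambda>h. \<omega>' (fst p) \<bullet> h)) (at (fst p) within U)"
    using \<omega> X(2)[OF pX] unfolding dist_gen_fun_def strongly_convex_on_def by auto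
  define c where "c = \<omega>' (fst x) \<bullet> (fst z - fst p) - \<xi> \<bullet> (z - p)"
  note lim = directional_derivative_within_convex[OF d U X(2)[OF pX] X(2)[OF z]]
  have "c \<le> (\<omega> (fst p + a *\<^sub>R (fst z - fst p)) - \<omega> (fst p)) / a" if a: "0 < a" "a < 1" for a :: real
  proof -
    define q where "q = p + a *\<^sub>R (z - p)"
    have "q = (1 - a) *\<^sub>R p + a *\<^sub>R z"
      by (simp add: q_def algebra_simps)
    with a pX z have "q \<in> X"
      by (auto intro!: convexD[OF X(1)])
    from min[OF this] have "\<xi> \<bullet> p + bregman \<omega> \<omega>' (fst x) (fst p) \<le> \<xi> \<bullet> q + bregman \<omega> \<omega>' (fst x) (fst q)" .
    then have "a * c \<le> \<omega> (fst p + a *\<^sub>R (fst z - fst p)) - \<omega> (fst p)"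
      by (simp add: q_def c_def bregman_def algebra_simps)
    with a show ?thesis
      by (simp add: field_simps)
  qed
  then have "\<forall>\<^sub>F a in at_right (0::real). c \<le> (\<omega> (fst p + a *\<^sub>R (fst z - fst p)) - \<omega> (fst p)) / a"
    by (auto simp: eventually_at_right_field intro!: exI[of _ 1])
  from tendsto_lowerbound[OF lim this] have "c \<le> \<omega>' (fst p) \<bullet> (fst z - fst p)"
    by simp
  then show ?thesis
    unfolding bregman_three_point c_def by (simp add: algebra_simps)
qed

section \<open>The regret bound\<close>

text \<open>Splitting \<open>F (y) \<bullet> (y - z)\<close> at the new iterate \<open>x'\<close> leaves the error
  \<open>(F (y) - F (x)) \<bullet> (y - x')\<close> of having extrapolated with \<open>F (x)\<close>; it only involves \<open>Fu\<close>.\<close>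

lemma mirror_prox_step:
  fixes X :: "('u::euclidean_space \<times> 'v::euclidean_space) set"
  assumes \<omega>: "dist_gen_fun N U \<omega> \<omega>'" and X: "convex X" "\<And>z. z \<in> X \<Longrightarrow> fst z \<in> U"
    and F: "\<And>z. z \<in> X \<Longrightarrow> F z = composite_field Fu Fv z"
    and x: "x \<in> X"
    and y: "y \<in> prox_set \<omega> \<omega>' X x (\<gamma> *\<^sub>R F x)" and x': "x' \<in> prox_set \<omega> \<omega>' X x (\<gamma> *\<^sub>R F y)"
    and step: "\<gamma> * ((Fu (fst y) - Fu (fst x)) \<bullet> (fst y - fst x'))
        - bregman \<omega> \<omega>' (fst y) (fst x') - bregman \<omega> \<omega>' (fst x) (fst y) \<le> e"
    and z: "z \<in> X"
  shows "\<gamma> * (F y \<bullet> (y - z)) \<le> bregman \<omega> \<omega>' (fst x) (fst z) - bregman \<omega> \<omega>' (fst x') (fst z) + e"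
proof -
  have yX: "y \<in> X" and x'X: "x' \<in> X"
    using y x' unfolding prox_set_def is_arg_min_def by auto
  have "\<gamma> *\<^sub>R F y \<bullet> (x' - z) \<le> bregman \<omega> \<omega>' (fst x) (fst z)
      - bregman \<omega> \<omega>' (fst x') (fst z) - bregman \<omega> \<omega>' (fst x) (fst x')"
    by (rule prox_three_point[OF \<omega> X x' z])
  moreover have "\<gamma> *\<^sub>R F x \<bullet> (y - x') \<le> bregman \<omega> \<omega>' (fst x) (fst x')
      - bregman \<omega> \<omega>' (fst y) (fst x') - bregman \<omega> \<omega>' (fst x) (fst y)"
    by (rule prox_three_point[OF \<omega> X y x'X])
  moreover have "\<gamma> * ((F y - F x) \<bullet> (y - x')) = \<gamma> * ((Fu (fst y) - Fu (fst x)) \<bullet> (fst y - fst x'))"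
    by (simp add: F[OF yX] F[OF x] composite_field_def inner_prod_def)
  moreover have "\<gamma> * (F y \<bullet> (y - z)) =
      \<gamma> *\<^sub>R F y \<bullet> (x' - z) + \<gamma> *\<^sub>R F x \<bullet> (y - x') + \<gamma> * ((F y - F x) \<bullet> (y - x'))"
    by (simp add: algebra_simps)
  ultimately show ?thesis
    using step by linarith
qed

lemma mirror_prox_iterates_mem:
  fixes x y :: "nat \<Rightarrow> 'u::euclidean_space \<times> 'v::euclidean_space"
  assumes "x 1 \<in> X"
    and y: "\<forall>\<tau>\<ge>1. y \<tau> \<in> prox_set \<omega> \<omega>' X (x \<tau>) (\<gamma> \<tau> *\<^sub>R F (x \<tau>))"
    and x: "\<forall>\<tau>\<ge>1. x (\<tau> + 1) \<in> prox_set \<omega> \<omega>' X (x \<tau>) (\<gamma> \<tau> *\<^sub>R F (y \<tau>))"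
    and "1 \<le> \<tau>"
  shows "x \<tau> \<in> X" "y \<tau> \<in> X"
proof -
  have sub: "prox_set \<omega> \<omega>' X p \<xi> \<subseteq> X" for p \<xi>
    by (auto simp: prox_set_def is_arg_min_def)
  show "y \<tau> \<in> X"
    using y sub \<open>1 \<le> \<tau>\<close> by blast
  show "x \<tau> \<in> X"
    using \<open>1 \<le> \<tau>\<close>
  proof (induction rule: dec_induct)
    case (step n)
    then show ?case
      using x sub by (metis Suc_eq_plus1 subsetD)
  qed fact
qed

lemma mirror_prox_regret:
  fixes X :: "('u::euclidean_space \<times> 'v::euclidean_space) set" and x y :: "nat \<Rightarrow> 'u \<times> 'v"
  assumes \<omega>: "dist_gen_fun N U \<omega> \<omega>'" and X: "convex X" "\<And>z. z \<in> X \<Longrightarrow> fst z \<in> U"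
    and F: "\<And>z. z \<in> X \<Longrightarrow> F z = composite_field Fu Fv z"
    and x1: "x 1 \<in> X"
    and y: "\<forall>\<tau>\<ge>1. y \<tau> \<in> prox_set \<omega> \<omega>' X (x \<tau>) (\<gamma> \<tau> *\<^sub>R F (x \<tau>))"
    and x: "\<forall>\<tau>\<ge>1. x (\<tau> + 1) \<in> prox_set \<omega> \<omega>' X (x \<tau>) (\<gamma> \<tau> *\<^sub>R F (y \<tau>))"
    and step: "\<forall>\<tau>\<ge>1. \<gamma> \<tau> * ((Fu (fst (y \<tau>)) - Fu (fst (x \<tau>))) \<bullet> (fst (y \<tau>) - fst (x (\<tau> + 1))))
           - bregman \<omega> \<omega>' (fst (y \<tau>)) (fst (x (\<tau> + 1)))
           - bregman \<omega> \<omega>' (fst (x \<tau>)) (fst (y \<tau>)) \<le> e \<tau>"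
    and z: "z \<in> X"
  shows "(\<Sum>\<tau>=1..t. \<gamma> \<tau> * (F (y \<tau>) \<bullet> (y \<tau> - z))) \<le> bregman \<omega> \<omega>' (fst (x 1)) (fst z) + (\<Sum>\<tau>=1..t. e \<tau>)"
proof -
  note mem = mirror_prox_iterates_mem[OF x1 y x]
  have "(\<Sum>\<tau>=1..t. \<gamma> \<tau> * (F (y \<tau>) \<bullet> (y \<tau> - z)))
      \<le> bregman \<omega> \<omega>' (fst (x 1)) (fst z) - bregman \<omega> \<omega>' (fst (x (t + 1))) (fst z) + (\<Sum>\<tau>=1..t. e \<tau>)"
  proof (induction t)
    case (Suc t)
    have "\<gamma> (Suc t) * (F (y (Suc t)) \<bullet> (y (Suc t) - z)) \<le>
        bregman \<omega> \<omega>' (fst (x (Suc t))) (fst z) - bregman \<omega> \<omega>' (fst (x (Suc t + 1))) (fst z) + e (Suc t)"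
      using y x step by (intro mirror_prox_step[OF \<omega> X F mem(1) _ _ _ z]) auto
    with Suc show ?case
      by simp
  qed simp
  moreover have "0 \<le> bregman \<omega> \<omega>' (fst (x (t + 1))) (fst z)"
    using mem(1)[of "t + 1"] X(2) z by (intro bregman_nonneg[OF \<omega>]) auto
  ultimately show ?thesis
    by linarith
qed

section \<open>From regret to accuracy of the averaged point\<close>

lemma weighted_avg_conv: "weighted_avg \<gamma> y t = (\<Sum>\<tau>=1..t. (\<gamma> \<tau> / (\<Sum>\<sigma>=1..t. \<gamma> \<sigma>)) *\<^sub>R y \<tau>)"
  by (simp add: weighted_avg_def scaleR_sum_right divide_inverse mult.commute)

lemma linear_weighted_avg:
  "linear f \<Longrightarrow> f (weighted_avg \<gamma> y t) = weighted_avg \<gamma> (\<lambda>\<tau>. f (y \<tau>)) t"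
  by (simp add: weighted_avg_def linear_scale linear_sum)

lemma weights_sum_1:
  fixes \<gamma> :: "nat \<Rightarrow> real"
  assumes "0 < (\<Sum>\<tau>=1..t. \<gamma> \<tau>)"
  shows "(\<Sum>\<tau>=1..t. \<gamma> \<tau> / (\<Sum>\<sigma>=1..t. \<gamma> \<sigma>)) = 1"
  using assms by (simp flip: sum_divide_distrib)

lemma weighted_avg_mem_convex:
  assumes "convex S" "\<And>\<tau>. 1 \<le> \<tau> \<Longrightarrow> 0 \<le> \<gamma> \<tau>" "0 < (\<Sum>\<tau>=1..t. \<gamma> \<tau>)" "\<And>\<tau>. 1 \<le> \<tau> \<Longrightarrow> y \<tau> \<in> S"
  shows "weighted_avg \<gamma> y t \<in> S"
  unfolding weighted_avg_conv
  using assms by (intro convex_sum weights_sum_1) auto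

lemma weighted_avg_convex_on:
  assumes f: "convex_on S f" and "\<And>\<tau>. 1 \<le> \<tau> \<Longrightarrow> 0 \<le> \<gamma> \<tau>" and pos: "0 < (\<Sum>\<tau>=1..t. \<gamma> \<tau>)"
    and "\<And>\<tau>. 1 \<le> \<tau> \<Longrightarrow> y \<tau> \<in> S"
  shows "f (weighted_avg \<gamma> y t) \<le> inverse (\<Sum>\<tau>=1..t. \<gamma> \<tau>) * (\<Sum>\<tau>=1..t. \<gamma> \<tau> * f (y \<tau>))"
proof -
  have ne: "{1..t} \<noteq> {}"
    using pos by (metis sum.empty less_irrefl)
  have "f (weighted_avg \<gamma> y t) \<le> (\<Sum>\<tau>=1..t. (\<gamma> \<tau> / (\<Sum>\<sigma>=1..t. \<gamma> \<sigma>)) * f (y \<tau>))"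
    unfolding weighted_avg_conv
    using assms ne convex_on_imp_convex[OF f] by (intro convex_on_sum[OF _ _ f] weights_sum_1) auto
  then show ?thesis
    by (simp add: sum_distrib_left divide_inverse mult_ac)
qed

lemma monotone_gap_avg_le_regret:
  fixes X :: "'e::real_inner set"
  assumes F: "monotone_field_on X F"
    and \<gamma>: "\<And>\<tau>. 1 \<le> \<tau> \<Longrightarrow> 0 \<le> \<gamma> \<tau>" "0 < (\<Sum>\<tau>=1..t. \<gamma> \<tau>)" and y: "\<And>\<tau>. 1 \<le> \<tau> \<Longrightarrow> y \<tau> \<in> X"
    and z: "z \<in> X"
  shows "F z \<bullet> (weighted_avg \<gamma> y t - z) \<le>
    inverse (\<Sum>\<tau>=1..t. \<gamma> \<tau>) * (\<Sum>\<tau>=1..t. \<gamma> \<tau> * (F (y \<tau>) \<bullet> (y \<tau> - z)))"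
proof -
  have "F z \<bullet> (weighted_avg \<gamma> y t - z) = inverse (\<Sum>\<tau>=1..t. \<gamma> \<tau>) * (\<Sum>\<tau>=1..t. \<gamma> \<tau> * (F z \<bullet> (y \<tau> - z)))"
    using \<gamma>(2) by (simp add: weighted_avg_def inner_diff_right inner_sum_right right_diff_distrib
        sum_subtractf flip: sum_distrib_right)
  also have "\<dots> \<le> inverse (\<Sum>\<tau>=1..t. \<gamma> \<tau>) * (\<Sum>\<tau>=1..t. \<gamma> \<tau> * (F (y \<tau>) \<bullet> (y \<tau> - z)))"
  proof (intro mult_left_mono sum_mono)
    fix \<tau> assume \<tau>: "\<tau> \<in> {1..t}"
    then have "0 \<le> (F (y \<tau>) - F z) \<bullet> (y \<tau> - z)"
      using F y z unfolding monotone_field_on_def by auto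
    then show "F z \<bullet> (y \<tau> - z) \<le> F (y \<tau>) \<bullet> (y \<tau> - z)"
      by (simp add: inner_diff_left)
  qed (use \<gamma> in auto)
  finally show ?thesis .
qed

text \<open>The two subgradient inequalities at \<open>y\<close> are taken against \<open>z\<^sup>1\<close> and \<open>z\<^sup>2\<close>; the value of
  the cost at \<open>y\<close> cancels between them.\<close>

lemma associated_field_gap:
  assumes J: "euclidean_iso J" and F: "associated_field J X1 X2 \<Phi> F"
    and y: "J y \<in> X1 \<times> X2" and z: "J z \<in> X1 \<times> X2"
  shows "\<Phi> (fst (J y)) (snd (J z)) - \<Phi> (fst (J z)) (snd (J y)) \<le> F y \<bullet> (y - z)"
proof -
  obtain y1 y2 z1 z2 where e: "J y = (y1, y2)" "J z = (z1, z2)"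
    by (metis prod.exhaust)
  have 1: "\<Phi> y1 y2 + fst (J (F y)) \<bullet> (z1 - y1) \<le> \<Phi> z1 y2"
    and 2: "- \<Phi> y1 y2 + snd (J (F y)) \<bullet> (z2 - y2) \<le> - \<Phi> y1 z2"
    using F y z e unfolding associated_field_def subdifferential_def by auto
  have "F y \<bullet> (y - z) = J (F y) \<bullet> (J y - J z)"
    using J by (metis euclidean_iso_def linear_diff)
  also have "\<dots> = - (fst (J (F y)) \<bullet> (z1 - y1)) - snd (J (F y)) \<bullet> (z2 - y2)"
    by (simp add: e inner_prod_def inner_diff_right)
  finally show ?thesis
    using 1 2 e by simp
qed

lemma saddle_gap_avg_le_regret:
  assumes J: "euclidean_iso J" and F: "associated_field J X1 X2 \<Phi> F"
    and \<Phi>: "\<forall>x2\<in>X2. convex_on X1 (\<lambda>x1. \<Phi> x1 x2)" "\<forall>x1\<in>X1. concave_on X2 (\<Phi> x1)"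
    and \<gamma>: "\<And>\<tau>. 1 \<le> \<tau> \<Longrightarrow> 0 \<le> \<gamma> \<tau>" "0 < (\<Sum>\<tau>=1..t. \<gamma> \<tau>)"
    and y: "\<And>\<tau>. 1 \<le> \<tau> \<Longrightarrow> J (y \<tau>) \<in> X1 \<times> X2"
    and z: "J z \<in> X1 \<times> X2"
  shows "\<Phi> (fst (J (weighted_avg \<gamma> y t))) (snd (J z)) - \<Phi> (fst (J z)) (snd (J (weighted_avg \<gamma> y t))) \<le>
    inverse (\<Sum>\<tau>=1..t. \<gamma> \<tau>) * (\<Sum>\<tau>=1..t. \<gamma> \<tau> * (F (y \<tau>) \<bullet> (y \<tau> - z)))"
proof -
  let ?\<Gamma> = "\<Sum>\<tau>=1..t. \<gamma> \<tau>"
  have lin: "linear (\<lambda>x. fst (J x))" "linear (\<lambda>x. snd (J x))"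
    using linear_compose[OF _ linear_fst, of J] linear_compose[OF _ linear_snd, of J] J
    by (simp_all add: euclidean_iso_def o_def)
  have z1: "fst (J z) \<in> X1" and z2: "snd (J z) \<in> X2"
    using z by auto
  have mem: "fst (J (y \<tau>)) \<in> X1" "snd (J (y \<tau>)) \<in> X2" if "1 \<le> \<tau>" for \<tau>
    using y[OF that] by auto
  have "\<Phi> (fst (J (weighted_avg \<gamma> y t))) (snd (J z)) \<le> inverse ?\<Gamma> * (\<Sum>\<tau>=1..t. \<gamma> \<tau> * \<Phi> (fst (J (y \<tau>))) (snd (J z)))"
    unfolding linear_weighted_avg[OF lin(1)]
    using \<Phi>(1) z2 by (intro weighted_avg_convex_on[OF _ \<gamma> mem(1)]) auto
  moreover have "- \<Phi> (fst (J z)) (snd (J (weighted_avg \<gamma> y t))) \<le> inverse ?\<Gamma> * (\<Sum>\<tau>=1..t. \<gamma> \<tau> * - \<Phi> (fst (J z)) (snd (J (y \<tau>))))"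
    unfolding linear_weighted_avg[OF lin(2)]
    using \<Phi>(2) z1 by (intro weighted_avg_convex_on[OF _ \<gamma> mem(2)]) (auto simp: concave_on_def)
  ultimately have "\<Phi> (fst (J (weighted_avg \<gamma> y t))) (snd (J z)) - \<Phi> (fst (J z)) (snd (J (weighted_avg \<gamma> y t))) \<le>
      inverse ?\<Gamma> * (\<Sum>\<tau>=1..t. \<gamma> \<tau> * (\<Phi> (fst (J (y \<tau>))) (snd (J z)) - \<Phi> (fst (J z)) (snd (J (y \<tau>)))))"
    by (simp add: right_diff_distrib sum_subtractf sum_negf)
  also have "\<dots> \<le> inverse ?\<Gamma> * (\<Sum>\<tau>=1..t. \<gamma> \<tau> * (F (y \<tau>) \<bullet> (y \<tau> - z)))"
    using \<gamma> y z by (intro mult_left_mono sum_mono associated_field_gap[OF J F]) auto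
  finally show ?thesis .
qed

text \<open>If \<open>C = \<infinity>\<close> there is nothing to show. Otherwise the bound with \<open>z1\<close>
  fixed makes the supremum over \<open>z2\<close> finite, and varying \<open>z1\<close> then makes the infimum finite, so
  that their difference is not affected by the convention for \<open>\<infinity> - \<infinity>\<close>.\<close>

lemma eps_Sad_le:
  assumes ne: "X1 \<noteq> {}" "X2 \<noteq> {}"
    and gap: "\<And>z1 z2. z1 \<in> X1 \<Longrightarrow> z2 \<in> X2 \<Longrightarrow> ereal (\<Phi> (fst p) z2 - \<Phi> z1 (snd p)) \<le> C"
  shows "eps_Sad X1 X2 \<Phi> p \<le> C"
proof (cases C)
  case (real c)
  obtain a b where ab: "a \<in> X1" "b \<in> X2"
    using ne by auto
  let ?u = "Phi_upper X2 \<Phi> (fst p)" and ?l = "Phi_lower X1 \<Phi> (snd p)"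
  have u: "?u \<le> ereal (c + \<Phi> z1 (snd p))" if "z1 \<in> X1" for z1
    unfolding Phi_upper_def
    using gap[OF that] real by (intro SUP_least) (force simp: algebra_simps)
  have "ereal (\<Phi> (fst p) b) \<le> ?u"
    unfolding Phi_upper_def by (rule SUP_upper[OF ab(2)])
  with u[OF ab(1)] obtain r where r: "?u = ereal r"
    by (cases ?u) auto
  have "ereal (r - c) \<le> ?l"
    unfolding Phi_lower_def using u r by (intro INF_greatest) (force simp: algebra_simps)
  moreover have "?l \<le> ereal (\<Phi> a (snd p))"
    unfolding Phi_lower_def by (rule INF_lower[OF ab(1)])
  ultimately show ?thesis
    using r real by (cases ?l) (auto simp: eps_Sad_def)
next
  case MInf
  with gap ne show ?thesis by fastforce
qed simp

lemma regret_le_Theta: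
  assumes c: "0 < c" and reg: "R \<le> bregman \<omega> \<omega>' u (fst z) + e" and z: "z \<in> X'"
  shows "ereal (c * R) \<le> ereal c * (Theta \<omega> \<omega>' u X' + ereal e)"
proof -
  have "ereal (c * R) \<le> ereal c * (ereal (bregman \<omega> \<omega>' u (fst z)) + ereal e)"
    using c reg by simp
  also have "\<dots> \<le> ereal c * (Theta \<omega> \<omega>' u X' + ereal e)"
    unfolding Theta_def using c z
    by (intro ereal_mult_left_mono add_right_mono SUP_upper2[OF z]) auto
  finally show ?thesis .
qed

section \<open>Accuracy of Composite Mirror Prox\<close>

theorem corollary3p1:
  fixes N :: "'u::euclidean_space \<Rightarrow> real"
    and U :: "'u set" and \<omega> :: "'u \<Rightarrow> real" and \<omega>' :: "'u \<Rightarrow> 'u"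
    and X :: "('u \<times> 'v::euclidean_space) set"
    and Fu :: "'u \<Rightarrow> 'u" and Fv :: 'v and F :: "'u \<times> 'v \<Rightarrow> 'u \<times> 'v"
    and L M :: real
    and x y :: "nat \<Rightarrow> 'u \<times> 'v" and \<gamma> :: "nat \<Rightarrow> real" and t :: nat
  assumes U: "U \<noteq> {}" "closed U" "convex U"
    and X: "X \<noteq> {}" "closed X" "convex X"
    and A1: "is_norm N" "dist_gen_fun N U \<omega> \<omega>'"
    and A2: "\<forall>(u, v)\<in>X. u \<in> U"
    and A3: "\<forall>z\<in>X. F z = composite_field Fu Fv z" "0 \<le> L" "0 \<le> M"
      "\<forall>u\<in>U. \<forall>u'\<in>U. conj_norm N (Fu u - Fu u') \<le> L * N (u - u') + M"
    and A4: "bdd_below ((\<lambda>(u, v). Fv \<bullet> v) ` X)" "coercive_wrt_snd X Fv"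
    and start: "x 1 \<in> X"
    and step_y: "\<forall>\<tau>\<ge>1. y \<tau> \<in> prox_set \<omega> \<omega>' X (x \<tau>) (\<gamma> \<tau> *\<^sub>R F (x \<tau>))"
    and step_x: "\<forall>\<tau>\<ge>1. x (\<tau> + 1) \<in> prox_set \<omega> \<omega>' X (x \<tau>) (\<gamma> \<tau> *\<^sub>R F (y \<tau>))"
    and stepsize: "\<forall>\<tau>\<ge>1. 0 < \<gamma> \<tau>"
      "\<forall>\<tau>\<ge>1. \<gamma> \<tau> * ((Fu (fst (y \<tau>)) - Fu (fst (x \<tau>))) \<bullet> (fst (y \<tau>) - fst (x (\<tau> + 1))))
           - bregman \<omega> \<omega>' (fst (y \<tau>)) (fst (x (\<tau> + 1)))
           - bregman \<omega> \<omega>' (fst (x \<tau>)) (fst (y \<tau>)) \<le> (\<gamma> \<tau>)\<^sup>2 * M\<^sup>2"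
    and t: "1 \<le> t"
  shows "weighted_avg \<gamma> y t \<in> X
    \<and> (monotone_field_on X F \<longrightarrow>
         eps_VI X F (weighted_avg \<gamma> y t) \<le>
           ereal (inverse (\<Sum>\<tau>=1..t. \<gamma> \<tau>)) *
             (Theta \<omega> \<omega>' (fst (x 1)) X + ereal (M\<^sup>2 * (\<Sum>\<tau>=1..t. (\<gamma> \<tau>)\<^sup>2))))
    \<and> (\<forall>(J :: 'u \<times> 'v \<Rightarrow> 'a::euclidean_space \<times> 'b::euclidean_space) X1 X2 \<Phi>.
         euclidean_iso J \<and> closed X1 \<and> convex X1 \<and> closed X2 \<and> convex X2 \<and> J ` X = X1 \<times> X2 \<and>
         convex_concave_cost X1 X2 \<Phi> \<and> saddle_proper X1 X2 \<Phi> \<and> associated_field J X1 X2 \<Phi> F \<longrightarrow>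
           eps_Sad X1 X2 \<Phi> (J (weighted_avg \<gamma> y t)) \<le>
             ereal (inverse (\<Sum>\<tau>=1..t. \<gamma> \<tau>)) *
               (Theta \<omega> \<omega>' (fst (x 1)) X + ereal (M\<^sup>2 * (\<Sum>\<tau>=1..t. (\<gamma> \<tau>)\<^sup>2)))
           \<and> (\<forall>x1s. is_arg_min (Phi_upper X2 \<Phi>) (\<lambda>x1. x1 \<in> X1) x1s \<longrightarrow>
                Phi_upper X2 \<Phi> (fst (J (weighted_avg \<gamma> y t))) - Opt_P X1 X2 \<Phi> \<le>
                  ereal (inverse (\<Sum>\<tau>=1..t. \<gamma> \<tau>)) *
                    (Theta \<omega> \<omega>' (fst (x 1)) (J -` ({x1s} \<times> X2))
                       + ereal (M\<^sup>2 * (\<Sum>\<tau>=1..t. (\<gamma> \<tau>)\<^sup>2)))))"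
proof -
  \<comment> \<open>\<open>B X'\<close> is the right-hand side of all three estimates, and \<open>R z\<close> the regret against \<open>z\<close>.\<close>
  define G where "G = (\<Sum>\<tau>=1..t. \<gamma> \<tau>)"
  define xt where "xt = weighted_avg \<gamma> y t"
  define e where "e = M\<^sup>2 * (\<Sum>\<tau>=1..t. (\<gamma> \<tau>)\<^sup>2)"
  define B where "B X' = ereal (inverse G) * (Theta \<omega> \<omega>' (fst (x 1)) X' + ereal e)" for X' :: "('u \<times> 'v) set"
  define R where "R z = (\<Sum>\<tau>=1..t. \<gamma> \<tau> * (F (y \<tau>) \<bullet> (y \<tau> - z)))" for z
  have G: "0 < G"
    unfolding G_def using stepsize(1) t by (intro sum_pos) auto
  have \<gamma>: "0 \<le> \<gamma> \<tau>" if "1 \<le> \<tau>" for \<tau>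
    using stepsize(1) that by (simp add: less_imp_le)
  have y: "y \<tau> \<in> X" if "1 \<le> \<tau>" for \<tau>
    by (rule mirror_prox_iterates_mem(2)[OF start step_y step_x that])
  have xt: "xt \<in> X"
    unfolding xt_def using G \<gamma> y X(3) by (intro weighted_avg_mem_convex) (auto simp: G_def)
  have regret: "R z \<le> bregman \<omega> \<omega>' (fst (x 1)) (fst z) + e" if "z \<in> X" for z
    unfolding R_def e_def sum_distrib_left
    by (rule mirror_prox_regret[OF A1(2) X(3) _ _ start step_y step_x _ that])
      (use A2 A3(1) stepsize(2) in \<open>auto simp: mult.commute\<close>)
  have R_le: "ereal (inverse G * R z) \<le> B X'" if "z \<in> X" "z \<in> X'" for z X'
    unfolding B_def using G regret[OF that(1)] that(2) by (intro regret_le_Theta) auto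
  have vi: "eps_VI X F xt \<le> B X" if "monotone_field_on X F"
    unfolding eps_VI_def
  proof (rule SUP_least)
    fix z assume z: "z \<in> X"
    have "F z \<bullet> (xt - z) \<le> inverse G * R z"
      unfolding xt_def G_def R_def
      using that \<gamma> G y z by (intro monotone_gap_avg_le_regret[where X = X]) (auto simp: G_def)
    then show "ereal (F z \<bullet> (xt - z)) \<le> B X"
      using R_le[OF z z] by (meson ereal_less_eq(3) order_trans)
  qed
  have sad: "eps_Sad X1 X2 \<Phi> (J xt) \<le> B X \<and>
      (\<forall>x1s. is_arg_min (Phi_upper X2 \<Phi>) (\<lambda>x1. x1 \<in> X1) x1s \<longrightarrow>
        Phi_upper X2 \<Phi> (fst (J xt)) - Opt_P X1 X2 \<Phi> \<le> B (J -` ({x1s} \<times> X2)))"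
    if J: "euclidean_iso J" and JX: "J ` X = X1 \<times> X2" and \<Phi>: "convex_concave_cost X1 X2 \<Phi>"
      and proper: "saddle_proper X1 X2 \<Phi>" and F: "associated_field J X1 X2 \<Phi> F"
    for J :: "'u \<times> 'v \<Rightarrow> 'a \<times> 'b" and X1 X2 \<Phi>
  proof -
    have gap: "ereal (\<Phi> (fst (J xt)) z2 - \<Phi> z1 (snd (J xt))) \<le> B X'"
      if "z1 \<in> X1" "z2 \<in> X2" and X': "X \<inter> J -` {(z1, z2)} \<subseteq> X'" for z1 z2 X'
    proof -
      have "(z1, z2) \<in> J ` X"
        using that JX by auto
      then obtain z where z: "z \<in> X" "J z = (z1, z2)"
        by force
      have "\<Phi> (fst (J xt)) (snd (J z)) - \<Phi> (fst (J z)) (snd (J xt)) \<le> inverse G * R z"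
        unfolding xt_def G_def R_def
        using \<Phi> \<gamma> G y z(1) JX
        by (intro saddle_gap_avg_le_regret[OF J F]) (auto simp: G_def convex_concave_cost_def)
      moreover have "z \<in> X'"
        using z X' by auto
      ultimately show ?thesis
        using R_le[OF z(1)] z(2) by (force intro: order_trans[rotated])
    qed
    have Jxt: "fst (J xt) \<in> X1" "snd (J xt) \<in> X2"
      using imageI[OF xt, of J] unfolding JX by (auto simp: mem_Times_iff)
    have "eps_Sad X1 X2 \<Phi> (J xt) \<le> B X"
      using Jxt gap by (intro eps_Sad_le) auto
    moreover have "Phi_upper X2 \<Phi> (fst (J xt)) - Opt_P X1 X2 \<Phi> \<le> B (J -` ({x1s} \<times> X2))"
      if arg: "is_arg_min (Phi_upper X2 \<Phi>) (\<lambda>x1. x1 \<in> X1) x1s" for x1s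
    proof -
      have x1s: "x1s \<in> X1" and opt: "Opt_P X1 X2 \<Phi> = Phi_upper X2 \<Phi> x1s"
        using arg unfolding is_arg_min_def Opt_P_def
        by (auto simp: not_less intro!: antisym INF_lower INF_greatest)
      \<comment> \<open>A finite optimal value can be moved across the inequality in the extended reals.\<close>
      obtain v where v: "Opt_P X1 X2 \<Phi> = ereal v"
        using proper unfolding saddle_proper_def Opt_P_def
        by (cases "INF x1\<in>X1. Phi_upper X2 \<Phi> x1") auto
      have "ereal (\<Phi> x1s (snd (J xt))) \<le> ereal v"
        unfolding v[symmetric] opt Phi_upper_def by (rule SUP_upper[OF Jxt(2)])
      then have le_v: "\<Phi> x1s (snd (J xt)) \<le> v"
        by simp
      have "Phi_upper X2 \<Phi> (fst (J xt)) \<le> B (J -` ({x1s} \<times> X2)) + ereal v"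
        unfolding Phi_upper_def
      proof (rule SUP_least)
        fix z2 assume z2: "z2 \<in> X2"
        have "ereal (\<Phi> (fst (J xt)) z2) \<le> ereal (\<Phi> (fst (J xt)) z2 - \<Phi> x1s (snd (J xt))) + ereal v"
          using le_v by simp
        also have "\<dots> \<le> B (J -` ({x1s} \<times> X2)) + ereal v"
          using x1s z2 by (intro add_right_mono gap) auto
        finally show "ereal (\<Phi> (fst (J xt)) z2) \<le> B (J -` ({x1s} \<times> X2)) + ereal v" .
      qed
      then show ?thesis
        unfolding v by (simp add: ereal_minus_le_iff add.commute)
    qed
    ultimately show ?thesis
      by blast
  qed
  show ?thesis
    using xt vi sad unfolding xt_def B_def G_def e_def by blast
qed

end
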